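(* Let $0<\alpha\le\beta<\infty$. Let $Q$ be any probability distribution over $\mathbb S_{++}^d$ such that $$\Bigl(\int\sqrt{\lambda_{\min}(\Sigma)}\,dQ(\Sigma)\Bigr)^2\ge\alpha\qquad\text{and}\qquad\int\lambda_{\max}(\Sigma)\,dQ(\Sigma)\le\beta .$$ Then, for any matrix $\Sigma_0\in\mathbb S_{++}^d$ with all eigenvalues bounded below by $\frac{\alpha}{4}$ and any $0\le\eta\le\frac{\alpha}{2\beta}$, the generalized barycenter of $(1-\eta)\,\delta_{\Sigma_0}+\eta\,Q$ at $\Sigma_0$ also has all eigenvalues bounded below by $\frac{\alpha}{4}$.
   Context: $\mathbb S_{++}^d$ is the set of real symmetric positive definite $d\times d$ matrices; $\lambda_{\min},\lambda_{\max}$ denote the smallest and largest eigenvalue. For $\Sigma,\Sigma'\in\mathbb S_{++}^d$, the optimal transport map from $\mathcal N(0,\Sigma)$ to $\mathcal N(0,\Sigma')$ is the symmetric positive definite matrix $T_{\Sigma\to\Sigma'}=\Sigma^{-1/2}(\Sigma^{1/2}\Sigma'\Sigma^{1/2})^{1/2}\Sigma^{-1/2}$ (so $T_{\Sigma\to\Sigma}=I_d$). The generalized barycenter of a probability measure $R$ on $\mathbb S_{++}^d$ at the base point $\Sigma_0$ is the matrix $\bar T\,\Sigma_0\,\bar T$ with $\bar T=\int T_{\Sigma_0\to\Sigma}\,dR(\Sigma)$. In particular, for $R=(1-\eta)\delta_{\Sigma_0}+\eta Q$ one has $\bar T=(1-\eta)I_d+\eta\int T_{\Sigma_0\to\Sigma}\,dQ(\Sigma)$.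 *)

theory Defs
  imports "HOL-Probability.Probability"
begin

definition psd_matrices :: "(real ^ 'n ^ 'n) set" where
  "psd_matrices = {A. transpose A = A \<and> (\<forall>x. 0 \<le> x \<bullet> (A *v x))}"

definition spd_matrices :: "(real ^ 'n ^ 'n) set" where
  "spd_matrices = {A. transpose A = A \<and> (\<forall>x. x \<noteq> 0 \<longrightarrow> 0 < x \<bullet> (A *v x))}"

definition eigenvalues :: "real ^ 'n ^ 'n \<Rightarrow> real set" where
  "eigenvalues A = {c. \<exists>v. v \<noteq> 0 \<and> A *v v = c *s v}"

(* Both are used for symmetric matrices only; their set of real eigenvalues is
   finite and nonempty. *)
definition lambda_min :: "real ^ 'n ^ 'n \<Rightarrow> real" where
  "lambda_min A = Min (eigenvalues A)"

definition lambda_max :: "real ^ 'n ^ 'n \<Rightarrow> real" where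
  "lambda_max A = Max (eigenvalues A)"

(* The principal square root: a positive semidefinite matrix has exactly one
   positive semidefinite square root. *)
definition matrix_sqrt :: "real ^ 'n ^ 'n \<Rightarrow> real ^ 'n ^ 'n" where
  "matrix_sqrt A = (THE B. B \<in> psd_matrices \<and> B ** B = A)"

definition ot_map :: "real ^ 'n ^ 'n \<Rightarrow> real ^ 'n ^ 'n \<Rightarrow> real ^ 'n ^ 'n" where
  "ot_map S S' =
     matrix_inv (matrix_sqrt S)
       ** matrix_sqrt (matrix_sqrt S ** S' ** matrix_sqrt S)
       ** matrix_inv (matrix_sqrt S)"

(* The cone of positive definite matrices as a measurable space, with the Borel
   sets of its subspace topology. *)
definition spd_borel :: "(real ^ 'n ^ 'n) measure" where
  "spd_borel = restrict_space borel spd_matrices"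

definition mean_ot_map ::
    "real ^ 'n ^ 'n \<Rightarrow> (real ^ 'n ^ 'n) measure \<Rightarrow> real ^ 'n ^ 'n" where
  "mean_ot_map S0 R = (\<integral>S. ot_map S0 S \<partial>R)"

definition generalized_barycenter ::
    "real ^ 'n ^ 'n \<Rightarrow> (real ^ 'n ^ 'n) measure \<Rightarrow> real ^ 'n ^ 'n" where
  "generalized_barycenter S0 R = mean_ot_map S0 R ** S0 ** mean_ot_map S0 R"

(* (1 - t) M + t N, for 0 <= t <= 1 and measures M, N on the same measurable space. *)
definition mixture :: "real \<Rightarrow> 'a measure \<Rightarrow> 'a measure \<Rightarrow> 'a measure" where
  "mixture t M N = measure_of (space M) (sets M)
     (\<lambda>A. ennreal (1 - t) * emeasure M A + ennreal t * emeasure N A)"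

lemma space_mixture [simp]: "space (mixture t M N) = space M"
  and sets_mixture [simp]: "sets (mixture t M N) = sets M"
  by (simp_all add: mixture_def)

lemma emeasure_mixture:
  assumes "sets N = sets M" and A: "A \<in> sets M"
  shows "emeasure (mixture t M N) A = ennreal (1 - t) * emeasure M A + ennreal t * emeasure N A"
proof (rule emeasure_measure_of[OF mixture_def])
  show "sets M \<subseteq> Pow (space M)"
    by (rule sets.space_closed)
  show "positive (sets (mixture t M N))
      (\<lambda>A. ennreal (1 - t) * emeasure M A + ennreal t * emeasure N A)"
    by (simp add: positive_def)
  show "countably_additive (sets (mixture t M N))
      (\<lambda>A. ennreal (1 - t) * emeasure M A + ennreal t * emeasure N A)"
  proof (rule countably_additiveI)
    fix F :: "nat \<Rightarrow> 'a set"
    assume F: "range F \<subseteq> sets (mixture t M N)" "disjoint_family F"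
    have "(\<Sum>i. emeasure M (F i)) = emeasure M (\<Union>i. F i)"
         "(\<Sum>i. emeasure N (F i)) = emeasure N (\<Union>i. F i)"
      using F assms(1) by (auto intro!: suminf_emeasure)
    then show "(\<Sum>i. ennreal (1 - t) * emeasure M (F i) + ennreal t * emeasure N (F i)) =
        ennreal (1 - t) * emeasure M (\<Union>i. F i) + ennreal t * emeasure N (\<Union>i. F i)"
      by (simp add: suminf_add[symmetric])
  qed
  show "A \<in> sets (mixture t M N)"
    using A by simp
qed

end

theory Submission
  imports Defs
begin

text \<open>
  Let \<open>S\<close> be the square root of \<open>\<Sigma>\<^sub>0\<close> and \<open>T\<close> the mean transport map, so that the barycenter is
  \<open>T \<Sigma>\<^sub>0 T\<close> and \<open>v \<bullet> T \<Sigma>\<^sub>0 T v = |S T v|\<^sup>2\<close>.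

  Lower bound on \<open>T\<close>.  By operator monotonicity of the square root (\<open>sqrt_operator_monotone\<close>), the
  transport map from \<open>\<Sigma>\<^sub>0\<close> to \<open>\<Sigma>\<close> is at least \<open>sqrt (lambda_min \<Sigma>) S\<^sup>-\<^sup>1\<close> in the Loewner order
  (\<open>ot_map_ge\<close>).  Integrating, and using that the transport map from \<open>\<Sigma>\<^sub>0\<close> to itself is the identity,
  gives \<open>T \<ge> (1 - \<eta>) I + \<eta> sqrt \<alpha> S\<^sup>-\<^sup>1\<close> (\<open>inner_mean_ot_map_ge\<close>).  The bound on the mean of
  \<open>lambda_max\<close> makes the integral converge, through the companion upper bound \<open>ot_map_le\<close>.

  From \<open>T\<close> to the barycenter.  For an eigenvector \<open>v\<close> of the barycenter put \<open>w = S\<^sup>-\<^sup>1 v\<close>.  Then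
  \<open>|w| |S T v| \<ge> w \<bullet> S T v = v \<bullet> T v \<ge> (1 - \<eta>) |v|\<^sup>2 + \<eta> sqrt \<alpha> (v \<bullet> S\<^sup>-\<^sup>1 v)\<close>.
  The hypothesis on \<open>\<Sigma>\<^sub>0\<close> says \<open>S \<ge> a I\<close> with \<open>a = sqrt \<alpha> / 2\<close>, hence
  \<open>v \<bullet> S\<^sup>-\<^sup>1 v \<ge> a |w|\<^sup>2\<close> and \<open>a |w| \<le> |v|\<close>.  Since \<open>\<eta> \<le> 1/2\<close>, an elementary inequality shows
  that the right side is at least \<open>a |v| |w|\<close>, so \<open>|S T v| \<ge> a |v|\<close>, which is the claim
  (\<open>congruence_eigenvalue_ge\<close>).
\<close>

section \<open>Symmetric matrices and their eigenvalues\<close>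

lemma symmetric_matrix_iff:
  fixes A :: "real ^ 'n ^ 'n"
  shows "transpose A = A \<longleftrightarrow> (\<forall>x y. (A *v x) \<bullet> y = x \<bullet> (A *v y))"
proof
  assume "transpose A = A"
  then show "\<forall>x y. (A *v x) \<bullet> y = x \<bullet> (A *v y)"
    by (metis dot_lmul_matrix vector_transpose_matrix)
next
  assume *: "\<forall>x y. (A *v x) \<bullet> y = x \<bullet> (A *v y)"
  have "(transpose A *v x) \<bullet> y = (A *v x) \<bullet> y" for x y
    using * by (metis dot_lmul_matrix transpose_transpose vector_transpose_matrix)
  then show "transpose A = A"
    by (metis matrix_eq vector_eq_rdot)
qed

lemma symmetric_matrix_inner:
  fixes A :: "real ^ 'n ^ 'n"
  shows "transpose A = A \<Longrightarrow> (A *v x) \<bullet> y = x \<bullet> (A *v y)"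
  by (simp add: symmetric_matrix_iff)

lemma psd_symmetric: "A \<in> psd_matrices \<Longrightarrow> (A *v x) \<bullet> y = x \<bullet> (A *v y)"
  by (simp add: psd_matrices_def symmetric_matrix_inner)

lemma psd_nonneg: "A \<in> psd_matrices \<Longrightarrow> 0 \<le> x \<bullet> (A *v x)"
  by (simp add: psd_matrices_def)

lemma spd_imp_psd: "A \<in> spd_matrices \<Longrightarrow> A \<in> psd_matrices"
  by (auto simp: spd_matrices_def psd_matrices_def) (metis inner_zero_left less_eq_real_def)

lemma psdI:
  assumes "\<And>x y. (A *v x) \<bullet> y = x \<bullet> (A *v y)" "\<And>x. 0 \<le> x \<bullet> (A *v x)"
  shows "A \<in> psd_matrices"
  using assms by (simp add: psd_matrices_def symmetric_matrix_iff)

text \<open>The minimizer of the Rayleigh quotient on an invariant subspace \<open>V\<close> is an eigenvector.  The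
  version for a subspace, rather than for the whole space, is what lets eigenvectors be split off one
  after the other.\<close>
lemma symmetric_min_eigenvector:
  fixes A :: "real ^ 'n ^ 'n"
  assumes A: "transpose A = A" and V: "subspace V" "\<And>x. x \<in> V \<Longrightarrow> A *v x \<in> V" "V \<noteq> {0}"
  obtains v where "v \<in> V" "norm v = 1" "A *v v = (v \<bullet> (A *v v)) *\<^sub>R v"
    "\<And>x. x \<in> V \<Longrightarrow> (v \<bullet> (A *v v)) * (norm x)\<^sup>2 \<le> x \<bullet> (A *v x)"
proof -
  let ?q = "\<lambda>x. x \<bullet> (A *v x)"
  let ?K = "V \<inter> sphere 0 1"
  have "compact ?K"
    using V(1) by (simp add: closed_Int_compact closed_subspace)
  moreover obtain u where u: "u \<in> V" "u \<noteq> 0"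
    using V subspace_0 by blast
  then have "inverse (norm u) *\<^sub>R u \<in> ?K"
    using V(1) by (simp add: subspace_scale)
  then have "?K \<noteq> {}" by blast
  moreover have "continuous_on ?K ?q"
    by (intro continuous_intros)
  ultimately obtain v where v: "v \<in> ?K" "\<And>y. y \<in> ?K \<Longrightarrow> ?q v \<le> ?q y"
    using continuous_attains_inf[of ?K ?q] by blast
  define c where "c = ?q v"
  have lower: "c * (norm x)\<^sup>2 \<le> ?q x" if "x \<in> V" for x
  proof (cases "x = 0")
    case False
    let ?y = "inverse (norm x) *\<^sub>R x"
    have "?y \<in> ?K"
      using that False V(1) by (simp add: subspace_scale)
    then have "c \<le> ?q ?y"
      using v(2) c_def by blast
    also have "?q ?y = ?q x / (norm x)\<^sup>2"
      by (simp add: matrix_vector_mult_scaleR power2_eq_square divide_inverse)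
    finally show ?thesis
      using False by (simp add: field_simps)
  qed simp
  \<comment> \<open>The residual \<open>r\<close> lies in \<open>V\<close>; moving from \<open>v\<close> in the direction \<open>r\<close> would decrease
    the quadratic form of \<open>A - c I\<close> to first order unless \<open>r = 0\<close>.\<close>
  define r where "r = A *v v - c *\<^sub>R v"
  have rV: "r \<in> V"
    using v V unfolding r_def by (simp add: subspace_diff subspace_scale)
  have vv: "v \<bullet> v = 1"
    using v by (simp add: dot_square_norm)
  have main: "0 \<le> 2 * t * (r \<bullet> r) + t\<^sup>2 * (?q r - c * (r \<bullet> r))" for t
  proof -
    have "v + t *\<^sub>R r \<in> V"
      by (intro subspace_add subspace_scale V(1) rV) (use v(1) in blast)
    then have le: "c * ((v + t *\<^sub>R r) \<bullet> (v + t *\<^sub>R r)) \<le> ?q (v + t *\<^sub>R r)"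
      using lower by (simp add: dot_square_norm)
    have q: "?q (v + t *\<^sub>R r) = c + 2 * t * (r \<bullet> (A *v v)) + t\<^sup>2 * ?q r"
    proof -
      have "v \<bullet> (A *v r) = r \<bullet> (A *v v)"
        using symmetric_matrix_inner[OF A, of v r] by (simp add: inner_commute)
      then show ?thesis
        by (simp add: c_def matrix_vector_right_distrib matrix_vector_mult_scaleR inner_add_left
            inner_add_right power2_eq_square distrib_left)
    qed
    have rA: "r \<bullet> (A *v v) = r \<bullet> r + c * (r \<bullet> v)"
    proof -
      have "A *v v = r + c *\<^sub>R v"
        by (simp add: r_def)
      then show ?thesis
        by (simp only: inner_add_right inner_scaleR_right)
    qed
    have n: "(v + t *\<^sub>R r) \<bullet> (v + t *\<^sub>R r) = 1 + 2 * t * (r \<bullet> v) + t\<^sup>2 * (r \<bullet> r)"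
      by (simp add: inner_add_left inner_add_right vv inner_commute[of v r] power2_eq_square
          distrib_left)
    show ?thesis
      using le unfolding q rA n by (simp add: algebra_simps)
  qed
  have "r \<bullet> r = 0"
  proof (rule ccontr)
    assume "r \<bullet> r \<noteq> 0"
    then have pos: "r \<bullet> r > 0" by simp
    \<comment> \<open>Bounding the quadratic coefficient in \<open>main\<close> by \<open>k\<close>, the minimum over \<open>t\<close> is attained
      at \<open>t = - (r \<bullet> r) / k\<close>.\<close>
    define k where "k = \<bar>?q r - c * (r \<bullet> r)\<bar> + 1"
    have k: "k > 0" "?q r - c * (r \<bullet> r) \<le> k"
      by (auto simp: k_def)
    have "0 \<le> 2 * (- (r \<bullet> r) / k) * (r \<bullet> r) + (- (r \<bullet> r) / k)\<^sup>2 * (?q r - c * (r \<bullet> r))"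
      by (rule main)
    also have "\<dots> \<le> 2 * (- (r \<bullet> r) / k) * (r \<bullet> r) + (- (r \<bullet> r) / k)\<^sup>2 * k"
      using k by (intro add_left_mono mult_left_mono) auto
    also have "\<dots> = - (r \<bullet> r)\<^sup>2 / k"
      using k by (simp add: power2_eq_square field_simps)
    also have "\<dots> < 0"
      using k pos by simp
    finally show False by simp
  qed
  then have "A *v v = c *\<^sub>R v"
    by (simp add: r_def)
  then show thesis
    using that[of v] v(1) lower unfolding c_def by simp
qed

lemma symmetric_min_eigenvector_UNIV:
  fixes A :: "real ^ 'n ^ 'n"
  assumes A: "transpose A = A"
  obtains v where "norm v = 1" "A *v v = (v \<bullet> (A *v v)) *\<^sub>R v"
    "\<And>x. (v \<bullet> (A *v v)) * (norm x)\<^sup>2 \<le> x \<bullet> (A *v x)"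
proof -
  have "axis undefined 1 \<noteq> (0::real^'n)"
    by (metis axis_eq_0_iff zero_neq_one)
  then have "(UNIV :: (real^'n) set) \<noteq> {0}"
    by blast
  from symmetric_min_eigenvector[OF A subspace_UNIV _ this] that show thesis
    by (metis UNIV_I)
qed

lemma eigenvector_inner:
  assumes "A *v v = c *s v"
  shows "v \<bullet> (A *v v) = c * (norm v)\<^sup>2"
  using assms by (simp add: scalar_mult_eq_scaleR dot_square_norm)

text \<open>Eigenvectors for distinct eigenvalues are orthogonal, hence independent.\<close>
lemma finite_eigenvalues:
  fixes A :: "real ^ 'n ^ 'n"
  assumes A: "transpose A = A"
  shows "finite (eigenvalues A)"
proof -
  have "\<forall>c\<in>eigenvalues A. \<exists>v. v \<noteq> 0 \<and> A *v v = c *s v"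
    by (auto simp: eigenvalues_def)
  then obtain f where f: "\<And>c. c \<in> eigenvalues A \<Longrightarrow> f c \<noteq> 0 \<and> A *v (f c) = c *s (f c)"
    by metis
  have orth: "f c \<bullet> f d = 0" if "c \<in> eigenvalues A" "d \<in> eigenvalues A" "c \<noteq> d" for c d
  proof -
    have "c * (f c \<bullet> f d) = d * (f c \<bullet> f d)"
      using symmetric_matrix_inner[OF A, of "f c" "f d"] f that
      by (simp add: scalar_mult_eq_scaleR)
    with that show ?thesis by simp
  qed
  have inj: "inj_on f (eigenvalues A)"
    using orth f by (metis inj_onI inner_eq_zero_iff)
  have "pairwise orthogonal (f ` eigenvalues A)"
    using orth by (auto simp: pairwise_def orthogonal_def)
  then have "independent (f ` eigenvalues A)"
    using f by (intro pairwise_orthogonal_independent) auto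
  then have "finite (f ` eigenvalues A)"
    using independent_bound by blast
  with inj show ?thesis
    using finite_imageD by blast
qed

lemma lambda_min_le_inner:
  fixes A :: "real ^ 'n ^ 'n"
  assumes A: "transpose A = A"
  shows "lambda_min A * (norm x)\<^sup>2 \<le> x \<bullet> (A *v x)"
proof -
  obtain v where v: "norm v = 1" "A *v v = (v \<bullet> (A *v v)) *\<^sub>R v"
    "\<And>x. (v \<bullet> (A *v v)) * (norm x)\<^sup>2 \<le> x \<bullet> (A *v x)"
    using symmetric_min_eigenvector_UNIV[OF A] by blast
  then have "v \<bullet> (A *v v) \<in> eigenvalues A"
    unfolding eigenvalues_def by (intro CollectI exI[of _ v]) (auto simp: scalar_mult_eq_scaleR)
  then have "lambda_min A \<le> v \<bullet> (A *v v)"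
    unfolding lambda_min_def using finite_eigenvalues[OF A] by simp
  then show ?thesis
    using v(3)[of x] by (meson mult_right_mono order_trans zero_le_power2)
qed

lemma inner_le_lambda_max:
  fixes A :: "real ^ 'n ^ 'n"
  assumes A: "transpose A = A"
  shows "x \<bullet> (A *v x) \<le> lambda_max A * (norm x)\<^sup>2"
proof -
  have neg: "(- A) *v x = - (A *v x)" for x
    using scaleR_matrix_vector_assoc[of "-1" A x] by simp
  have "transpose (- A) = - A"
    using A by (simp add: symmetric_matrix_iff neg)
  then obtain v where v: "norm v = 1" "(- A) *v v = (v \<bullet> ((- A) *v v)) *\<^sub>R v"
    "\<And>x. (v \<bullet> ((- A) *v v)) * (norm x)\<^sup>2 \<le> x \<bullet> ((- A) *v x)"
    using symmetric_min_eigenvector_UNIV by blast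
  then have "v \<bullet> (A *v v) \<in> eigenvalues A"
    unfolding eigenvalues_def by (intro CollectI exI[of _ v]) (auto simp: scalar_mult_eq_scaleR neg)
  then have "v \<bullet> (A *v v) \<le> lambda_max A"
    unfolding lambda_max_def using finite_eigenvalues[OF A] by simp
  moreover have "x \<bullet> (A *v x) \<le> (v \<bullet> (A *v v)) * (norm x)\<^sup>2"
    using v(3)[of x] by (simp add: neg)
  ultimately show ?thesis
    by (meson mult_right_mono order_trans zero_le_power2)
qed

lemma lambda_min_in_eigenvalues:
  fixes A :: "real ^ 'n ^ 'n"
  assumes A: "transpose A = A"
  shows "lambda_min A \<in> eigenvalues A"
proof -
  obtain v where v: "norm v = 1" "A *v v = (v \<bullet> (A *v v)) *\<^sub>R v"
    using symmetric_min_eigenvector_UNIV[OF A] by blast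
  then have "v \<bullet> (A *v v) \<in> eigenvalues A"
    unfolding eigenvalues_def by (intro CollectI exI[of _ v]) (auto simp: scalar_mult_eq_scaleR)
  then show ?thesis
    unfolding lambda_min_def using finite_eigenvalues[OF A] by (auto intro!: Min_in)
qed

lemma lambda_min_pos:
  assumes A: "A \<in> spd_matrices"
  shows "0 < lambda_min A"
proof -
  have "transpose A = A"
    using A by (simp add: spd_matrices_def)
  then obtain v where v: "v \<noteq> 0" "A *v v = lambda_min A *s v"
    using lambda_min_in_eigenvalues by (auto simp: eigenvalues_def)
  then have "0 < lambda_min A * (norm v)\<^sup>2"
    using A v(1) eigenvector_inner[OF v(2)] unfolding spd_matrices_def by (metis (mono_tags, lifting) mem_Collect_eq)
  then show ?thesis
    by (simp add: zero_less_mult_iff)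
qed

section \<open>The positive semidefinite square root\<close>

text \<open>Operator monotonicity of the square root: for positive semidefinite matrices,
  \<open>B\<^sup>2 \<le> A\<^sup>2\<close> in the Loewner order (which is what the hypothesis on norms says) implies
  \<open>B \<le> A\<close>.  Let \<open>v\<close> be an eigenvector of \<open>A - B\<close> for its smallest eigenvalue \<open>c\<close>.  Then
  \<open>v \<bullet> (A\<^sup>2 - B\<^sup>2) v = c (v \<bullet> A v + v \<bullet> B v)\<close>, and the left side is nonnegative.  If \<open>c\<close> were
  negative, both terms in parentheses would vanish, and so would their difference \<open>c\<close>.
  Uniqueness and continuity of the root and the bounds on transport maps all rest on this.\<close>
lemma sqrt_operator_monotone:
  assumes A: "A \<in> psd_matrices" and B: "B \<in> psd_matrices"
    and le: "\<And>x. norm (B *v x) \<le> norm (A *v x)"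
  shows "x \<bullet> (B *v x) \<le> x \<bullet> (A *v x)"
proof -
  have "transpose (A - B) = A - B"
    using A B by (simp add: psd_symmetric symmetric_matrix_iff matrix_vector_mult_diff_rdistrib
        inner_diff_left inner_diff_right)
  then obtain v where v: "norm v = 1" "(A - B) *v v = (v \<bullet> ((A - B) *v v)) *\<^sub>R v"
    "\<And>x. (v \<bullet> ((A - B) *v v)) * (norm x)\<^sup>2 \<le> x \<bullet> ((A - B) *v x)"
    using symmetric_min_eigenvector_UNIV by blast
  define c where "c = v \<bullet> ((A - B) *v v)"
  have c: "c = v \<bullet> (A *v v) - v \<bullet> (B *v v)"
    by (simp add: c_def matrix_vector_mult_diff_rdistrib inner_diff_right)
  have Dv: "A *v v - B *v v = c *\<^sub>R v"
    using v(2) by (simp add: c_def matrix_vector_mult_diff_rdistrib)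
  have "0 \<le> (A *v v) \<bullet> (A *v v) - (B *v v) \<bullet> (B *v v)"
    using le[of v] by (simp add: dot_square_norm)
  also have "\<dots> = (A *v v - B *v v) \<bullet> (A *v v + B *v v)"
    by (simp add: inner_diff_left inner_diff_right inner_add_right inner_commute)
  also have "\<dots> = c * (v \<bullet> (A *v v) + v \<bullet> (B *v v))"
    by (simp add: Dv inner_add_right distrib_left)
  finally have "0 \<le> c * (v \<bullet> (A *v v) + v \<bullet> (B *v v))" .
  moreover have "0 \<le> v \<bullet> (A *v v)" "0 \<le> v \<bullet> (B *v v)"
    using A B by (simp_all add: psd_nonneg)
  ultimately have "0 \<le> c"
    using c by (smt (verit) mult_neg_pos)
  then have "0 \<le> x \<bullet> ((A - B) *v x)"
    using v(3)[of x] unfolding c_def by (smt (verit) mult_nonneg_nonneg zero_le_power2)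
  then show ?thesis
    by (simp add: matrix_vector_mult_diff_rdistrib inner_diff_right)
qed

lemma symmetric_eq_if_inner_eq:
  fixes A B :: "real ^ 'n ^ 'n"
  assumes A: "transpose A = A" and B: "transpose B = B"
    and eq: "\<And>x. x \<bullet> (A *v x) = x \<bullet> (B *v x)"
  shows "A = B"
proof -
  have "x \<bullet> (A *v y) = x \<bullet> (B *v y)" for x y
    using eq[of "x + y"] eq[of x] eq[of y] symmetric_matrix_inner[OF A, of x y]
      symmetric_matrix_inner[OF B, of x y]
    by (simp add: matrix_vector_right_distrib inner_add_left inner_add_right inner_commute)
  then show ?thesis
    by (metis matrix_eq vector_eq_ldot)
qed

lemma norm_psd_square:
  assumes "B \<in> psd_matrices" "B ** B = A"
  shows "(norm (B *v x))\<^sup>2 = x \<bullet> (A *v x)"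
proof -
  have "(norm (B *v x))\<^sup>2 = (B *v x) \<bullet> (B *v x)"
    by (simp add: dot_square_norm)
  also have "\<dots> = x \<bullet> (B *v (B *v x))"
    using assms(1) by (rule psd_symmetric)
  finally show ?thesis
    using assms(2) by (simp add: matrix_vector_mul_assoc)
qed

lemma psd_sqrt_unique:
  assumes "A \<in> psd_matrices" "B \<in> psd_matrices" "A ** A = B ** B"
  shows "A = B"
proof -
  have "norm (A *v x) = norm (B *v x)" for x
    using norm_psd_square[of A _ x] norm_psd_square[of B _ x] assms
    by (metis norm_ge_zero power2_eq_imp_eq)
  then have "x \<bullet> (A *v x) = x \<bullet> (B *v x)" for x
    using assms sqrt_operator_monotone[of A B x] sqrt_operator_monotone[of B A x] by force
  moreover have "transpose A = A" "transpose B = B"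
    using assms(1,2) by (simp_all add: psd_matrices_def)
  ultimately show ?thesis
    using symmetric_eq_if_inner_eq by blast
qed

text \<open>The spectral theorem.  An orthonormal set of eigenvectors of maximal size spans, since its
  orthogonal complement is invariant and would otherwise contain a further eigenvector.\<close>
lemma symmetric_orthonormal_eigenbasis:
  fixes A :: "real ^ 'n ^ 'n"
  assumes A: "transpose A = A"
  obtains E where "finite E"
    "\<And>b b'. b \<in> E \<Longrightarrow> b' \<in> E \<Longrightarrow> b \<bullet> b' = (if b = b' then 1 else 0)"
    "\<And>b. b \<in> E \<Longrightarrow> A *v b = (b \<bullet> (A *v b)) *\<^sub>R b"
    "\<And>x. x = (\<Sum>b\<in>E. (b \<bullet> x) *\<^sub>R b)"
proof -
  define P where "P E \<longleftrightarrow> (\<forall>b\<in>E. \<forall>b'\<in>E. b \<bullet> b' = (if b = b' then 1 else 0)) \<and>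
    (\<forall>b\<in>E. \<exists>c. A *v b = c *\<^sub>R b)" for E
  have P_bound: "finite E \<and> card E \<le> DIM(real^'n)" if "P E" for E
  proof -
    have "pairwise orthogonal E" "0 \<notin> E"
    proof -
      have E: "b \<bullet> b' = (if b = b' then 1 else 0)" if "b \<in> E" "b' \<in> E" for b b'
        using \<open>P E\<close> that unfolding P_def by blast
      show "pairwise orthogonal E"
        using E by (simp add: pairwise_def orthogonal_def)
      show "0 \<notin> E"
        using E[of 0 0] by auto
    qed
    then show ?thesis
      using pairwise_orthogonal_independent independent_bound by blast
  qed
  have "P {}" by (simp add: P_def)
  then obtain E where E: "P E" and max: "\<And>F. P F \<Longrightarrow> card F \<le> card E"
    using ex_has_greatest_nat[of P "{}" card "Suc DIM(real^'n)"] P_bound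
    by (meson le_imp_less_Suc)
  have fin: "finite E" using P_bound E by blast
  have on: "b \<bullet> b' = (if b = b' then 1 else 0)" if "b \<in> E" "b' \<in> E" for b b'
    using E that by (auto simp: P_def)
  have eig: "A *v b = (b \<bullet> (A *v b)) *\<^sub>R b" if b: "b \<in> E" for b
  proof -
    obtain c where c: "A *v b = c *\<^sub>R b"
      using E b unfolding P_def by blast
    have "b \<bullet> (A *v b) = c"
      using on[OF b b] by (simp add: c)
    with c show ?thesis by simp
  qed
  define V where "V = {x. \<forall>b\<in>E. b \<bullet> x = 0}"
  have V: "subspace V"
    by (auto simp: V_def subspace_def inner_add_right)
  have inv: "A *v x \<in> V" if "x \<in> V" for x
  proof -
    have "b \<bullet> (A *v x) = 0" if b: "b \<in> E" for b
    proof -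
      have "b \<bullet> (A *v x) = (A *v b) \<bullet> x"
        by (simp add: symmetric_matrix_inner[OF A])
      also have "\<dots> = (b \<bullet> (A *v b)) * (b \<bullet> x)"
        by (subst eig[OF b]) simp
      finally show ?thesis
        using \<open>x \<in> V\<close> b by (simp add: V_def)
    qed
    then show ?thesis by (simp add: V_def)
  qed
  have "V = {0}"
  proof (rule ccontr)
    assume "V \<noteq> {0}"
    then obtain v where v: "v \<in> V" "norm v = 1" "A *v v = (v \<bullet> (A *v v)) *\<^sub>R v"
      using symmetric_min_eigenvector[OF A V inv] by metis
    have vv: "v \<bullet> v = 1" using v by (simp add: dot_square_norm)
    have "v \<notin> E" using v(1) vv by (auto simp: V_def)
    moreover have "P (insert v E)"
      unfolding P_def
    proof (intro conjI ballI)
      have bv: "b \<bullet> v = 0" "v \<bullet> b = 0" if "b \<in> E" for b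
        using v(1) that by (simp_all add: V_def inner_commute)
      show "b \<bullet> b' = (if b = b' then 1 else 0)" if "b \<in> insert v E" "b' \<in> insert v E" for b b'
        using that on[of b b'] vv bv \<open>v \<notin> E\<close> by fastforce
      show "\<exists>c. A *v b = c *\<^sub>R b" if "b \<in> insert v E" for b
        using that v(3) eig[of b] by blast
    qed
    ultimately show False
      using max[of "insert v E"] fin by simp
  qed
  have "x = (\<Sum>b\<in>E. (b \<bullet> x) *\<^sub>R b)" for x
  proof -
    have "b \<bullet> (\<Sum>b'\<in>E. (b' \<bullet> x) *\<^sub>R b') = b \<bullet> x" if "b \<in> E" for b
    proof -
      have "b \<bullet> (\<Sum>b'\<in>E. (b' \<bullet> x) *\<^sub>R b') = (\<Sum>b'\<in>E. if b = b' then b' \<bullet> x else 0)"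
        unfolding inner_sum_right by (intro sum.cong) (auto simp: on that)
      then show ?thesis using that fin by simp
    qed
    then have "x - (\<Sum>b\<in>E. (b \<bullet> x) *\<^sub>R b) \<in> V"
      by (simp add: V_def inner_diff_right)
    then show ?thesis using \<open>V = {0}\<close> by simp
  qed
  with that fin on eig show thesis by blast
qed

lemma psd_sqrt_exists:
  fixes A :: "real ^ 'n ^ 'n"
  assumes A: "A \<in> psd_matrices"
  obtains B where "B \<in> psd_matrices" "B ** B = A"
proof -
  have sym: "transpose A = A"
    using A by (simp add: psd_matrices_def)
  obtain E where fin: "finite E"
    and on: "\<And>b b'. b \<in> E \<Longrightarrow> b' \<in> E \<Longrightarrow> b \<bullet> b' = (if b = b' then 1 else 0)"
    and eig: "\<And>b. b \<in> E \<Longrightarrow> A *v b = (b \<bullet> (A *v b)) *\<^sub>R b"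
    and exp: "\<And>x. x = (\<Sum>b\<in>E. (b \<bullet> x) *\<^sub>R b)"
    using symmetric_orthonormal_eigenbasis[OF sym] by blast
  define s where "s b = sqrt (b \<bullet> (A *v b))" for b
  have ss: "s b * s b = b \<bullet> (A *v b)" and s0: "s b \<ge> 0" for b
    using psd_nonneg[OF A, of b] by (auto simp: s_def)
  define f where "f x = (\<Sum>b\<in>E. (s b * (b \<bullet> x)) *\<^sub>R b)" for x
  have "linear f"
    unfolding f_def
    by (auto simp: linear_iff inner_add_right algebra_simps sum.distrib scaleR_sum_right)
  then have Bf: "matrix f *v x = f x" for x
    by (simp add: matrix_works)
  have bf: "b \<bullet> f x = s b * (b \<bullet> x)" if "b \<in> E" for b x
  proof -
    have "b \<bullet> f x = (\<Sum>b'\<in>E. if b = b' then s b' * (b' \<bullet> x) else 0)"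
      unfolding f_def inner_sum_right by (intro sum.cong) (auto simp: on that)
    then show ?thesis using that fin by simp
  qed
  have "matrix f \<in> psd_matrices"
  proof (rule psdI; unfold Bf)
    show "f x \<bullet> y = x \<bullet> f y" for x y
      unfolding f_def inner_sum_right inner_sum_left
      by (intro sum.cong) (auto simp: inner_commute)
    show "0 \<le> x \<bullet> f x" for x
      unfolding f_def inner_sum_right
      using s0 by (intro sum_nonneg) (auto simp: inner_commute mult.assoc)
  qed
  moreover have "matrix f ** matrix f = A"
  proof -
    have "f (f x) = A *v x" for x
    proof -
      have "A *v x = A *v (\<Sum>b\<in>E. (b \<bullet> x) *\<^sub>R b)"
        using exp[of x] by simp
      also have "\<dots> = (\<Sum>b\<in>E. (b \<bullet> x) *\<^sub>R (A *v b))"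
        by (simp add: linear_sum[OF matrix_vector_mul_linear] matrix_vector_mult_scaleR)
      also have "\<dots> = (\<Sum>b\<in>E. (b \<bullet> x) *\<^sub>R ((b \<bullet> (A *v b)) *\<^sub>R b))"
        by (intro sum.cong refl arg_cong[where f="scaleR _"]) (rule eig)
      also have "\<dots> = f (f x)"
        unfolding f_def[of "f x"]
        by (intro sum.cong) (auto simp: bf ss[symmetric] mult_ac)
      finally show ?thesis by simp
    qed
    then show ?thesis
      by (simp add: matrix_eq matrix_vector_mul_assoc[symmetric] Bf)
  qed
  ultimately show thesis by (rule that)
qed

text \<open>Existence and uniqueness together make the definite description in \<open>matrix_sqrt\<close> meaningful.\<close>
lemma matrix_sqrt:
  assumes "A \<in> psd_matrices"
  shows matrix_sqrt_psd: "matrix_sqrt A \<in> psd_matrices"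
    and matrix_sqrt_square: "matrix_sqrt A ** matrix_sqrt A = A"
proof -
  obtain B where "B \<in> psd_matrices" "B ** B = A"
    using psd_sqrt_exists[OF assms] .
  then have "\<exists>!B. B \<in> psd_matrices \<and> B ** B = A"
    using psd_sqrt_unique by metis
  from theI'[OF this] show "matrix_sqrt A \<in> psd_matrices" "matrix_sqrt A ** matrix_sqrt A = A"
    unfolding matrix_sqrt_def by blast+
qed

lemma matrix_sqrt_unique:
  "B \<in> psd_matrices \<Longrightarrow> B ** B = A \<Longrightarrow> matrix_sqrt A = B"
  unfolding matrix_sqrt_def using psd_sqrt_unique by (blast intro: the_equality)

section \<open>Norms, and continuity of the square root\<close>

lemma scaleR_mat_one_vector: "(c *\<^sub>R (mat 1 :: real ^ 'n ^ 'n)) *v x = c *\<^sub>R x"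
  by (simp add: scaleR_matrix_vector_assoc[symmetric])

lemma norm_matrix_vector_le:
  fixes A :: "real ^ 'n ^ 'n"
  shows "norm (A *v x) \<le> norm A * norm x"
proof -
  have "norm (A *v x) = L2_set (\<lambda>i. norm ((A *v x) $ i)) UNIV"
    by (simp add: norm_vec_def)
  also have "\<dots> \<le> L2_set (\<lambda>i. norm (A $ i) * norm x) UNIV"
    by (intro L2_set_mono) (simp_all add: matrix_vector_mul_component Cauchy_Schwarz_ineq2)
  also have "\<dots> = norm A * norm x"
    by (simp add: L2_set_left_distrib[symmetric] norm_vec_def)
  finally show ?thesis .
qed

lemma inner_matrix_le_norm:
  fixes A :: "real ^ 'n ^ 'n"
  shows "\<bar>x \<bullet> (A *v x)\<bar> \<le> norm A * (norm x)\<^sup>2"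
proof -
  have "\<bar>x \<bullet> (A *v x)\<bar> \<le> norm x * norm (A *v x)"
    by (rule Cauchy_Schwarz_ineq2)
  also have "\<dots> \<le> norm x * (norm A * norm x)"
    by (intro mult_left_mono norm_matrix_vector_le) simp
  finally show ?thesis
    by (simp add: power2_eq_square mult_ac)
qed

lemma matrix_entry_inner:
  fixes A :: "real ^ 'n ^ 'n"
  shows "A $ i $ j = axis i 1 \<bullet> (A *v axis j 1)"
  by (simp add: inner_axis' matrix_vector_mult_basis column_def)

text \<open>Reduces statements about the entries of a symmetric matrix to statements about its quadratic
  form, on which the Loewner order gives control.\<close>
lemma matrix_entry_polarization:
  fixes A :: "real ^ 'n ^ 'n"
  assumes A: "transpose A = A"
  defines "q \<equiv> \<lambda>x. x \<bullet> (A *v x)"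
  shows "A $ i $ j = (q (axis i 1 + axis j 1) - q (axis i 1 - axis j 1)) / 4"
  using symmetric_matrix_inner[OF A, of "axis i 1" "axis j 1"]
  by (simp add: q_def matrix_entry_inner matrix_vector_right_distrib matrix_vector_mult_diff_distrib
      inner_add_left inner_add_right inner_diff_left inner_diff_right inner_commute)

text \<open>By polarization an entry is a quarter of the difference of two values of the quadratic form at
  vectors of norm at most 2, both between \<open>0\<close> and \<open>4 K\<close>.\<close>
lemma norm_psd_le:
  fixes A :: "real ^ 'n ^ 'n"
  assumes A: "A \<in> psd_matrices" and K: "\<And>x. x \<bullet> (A *v x) \<le> K * (norm x)\<^sup>2"
  shows "norm A \<le> real CARD('n) * (real CARD('n) * K)"
proof -
  have K0: "K \<ge> 0"
    using K[of "axis undefined 1"] psd_nonneg[OF A, of "axis undefined 1"] by simp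
  have entry: "\<bar>A $ i $ j\<bar> \<le> K" for i j
  proof -
    let ?u = "axis i 1 :: real ^ 'n" and ?v = "axis j 1 :: real ^ 'n"
    have bound: "0 \<le> x \<bullet> (A *v x) \<and> x \<bullet> (A *v x) \<le> 4 * K" if "norm x \<le> 2" for x
    proof -
      have "(norm x)\<^sup>2 \<le> 2\<^sup>2"
        using that by (intro power_mono) auto
      then have "K * (norm x)\<^sup>2 \<le> K * 4"
        using K0 by (intro mult_left_mono) auto
      then show ?thesis
        using K[of x] psd_nonneg[OF A, of x] by simp
    qed
    have "norm (?u + ?v) \<le> 2" "norm (?u - ?v) \<le> 2"
      using norm_triangle_ineq[of ?u ?v] norm_triangle_ineq4[of ?u ?v] by simp_all
    then have "0 \<le> (?u + ?v) \<bullet> (A *v (?u + ?v)) \<and> (?u + ?v) \<bullet> (A *v (?u + ?v)) \<le> 4 * K"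
      "0 \<le> (?u - ?v) \<bullet> (A *v (?u - ?v)) \<and> (?u - ?v) \<bullet> (A *v (?u - ?v)) \<le> 4 * K"
      using bound by simp_all
    moreover have "A $ i $ j = ((?u + ?v) \<bullet> (A *v (?u + ?v)) - (?u - ?v) \<bullet> (A *v (?u - ?v))) / 4"
      using A by (intro matrix_entry_polarization) (simp add: psd_matrices_def)
    moreover have "\<bar>(p - q) / 4\<bar> \<le> K" if "0 \<le> p \<and> p \<le> 4 * K" "0 \<le> q \<and> q \<le> 4 * K" for p q
      using that by (simp add: abs_le_iff)
    ultimately show ?thesis by presburger
  qed
  have row: "norm (A $ i) \<le> real CARD('n) * K" for i
  proof -
    have "norm (A $ i) \<le> (\<Sum>j\<in>UNIV. \<bar>A $ i $ j\<bar>)"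
      by (rule norm_le_l1_cart)
    also have "\<dots> \<le> (\<Sum>j\<in>(UNIV::'n set). K)"
      by (intro sum_mono entry)
    finally show ?thesis by simp
  qed
  have "norm A \<le> (\<Sum>i\<in>UNIV. norm (A $ i))"
    unfolding norm_vec_def[of A] by (intro L2_set_le_sum) simp
  also have "\<dots> \<le> (\<Sum>i\<in>(UNIV::'n set). real CARD('n) * K)"
    by (intro sum_mono row)
  finally show ?thesis by simp
qed

text \<open>Operator monotonicity applied to \<open>A \<le> B + e\<^sup>2 I \<le> (sqrt B + e I)\<^sup>2\<close>: the square root is
  Hoelder continuous with exponent 1/2.\<close>
lemma matrix_sqrt_perturbation:
  fixes A B :: "real ^ 'n ^ 'n"
  assumes A: "A \<in> psd_matrices" and B: "B \<in> psd_matrices" and e: "0 \<le> e"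
    and le: "norm (A - B) \<le> e\<^sup>2"
  shows "x \<bullet> (matrix_sqrt A *v x) \<le> x \<bullet> (matrix_sqrt B *v x) + e * (norm x)\<^sup>2"
proof -
  let ?C = "matrix_sqrt B + e *\<^sub>R mat 1"
  have C: "?C *v y = matrix_sqrt B *v y + e *\<^sub>R y" for y
    by (simp add: matrix_vector_mult_add_rdistrib scaleR_mat_one_vector)
  note psd = matrix_sqrt_psd[OF A] matrix_sqrt_psd[OF B]
  have "?C \<in> psd_matrices"
    using e psd psd_nonneg[OF psd(2)]
    by (intro psdI) (auto simp: C inner_add_left inner_add_right psd_symmetric)
  moreover have "norm (matrix_sqrt A *v y) \<le> norm (?C *v y)" for y
  proof (rule power2_le_imp_le)
    have "(norm (matrix_sqrt A *v y))\<^sup>2 = y \<bullet> (B *v y) + y \<bullet> ((A - B) *v y)"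
      using norm_psd_square[OF psd(1) matrix_sqrt_square[OF A]]
      by (simp add: matrix_vector_mult_diff_rdistrib inner_diff_right)
    also have "y \<bullet> ((A - B) *v y) \<le> e\<^sup>2 * (norm y)\<^sup>2"
      using inner_matrix_le_norm[of y "A - B"] mult_right_mono[OF le, of "(norm y)\<^sup>2"] by simp
    also have "y \<bullet> (B *v y) = (norm (matrix_sqrt B *v y))\<^sup>2"
      using norm_psd_square[OF psd(2) matrix_sqrt_square[OF B]] by simp
    also have "(norm (matrix_sqrt B *v y))\<^sup>2 + e\<^sup>2 * (norm y)\<^sup>2
        \<le> (norm (matrix_sqrt B *v y))\<^sup>2 + 2 * e * (y \<bullet> (matrix_sqrt B *v y)) + e\<^sup>2 * (norm y)\<^sup>2"
      using e psd_nonneg[OF psd(2)] by simp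
    also have "\<dots> = (norm (?C *v y))\<^sup>2"
      unfolding C power2_norm_eq_inner
      by (simp add: inner_add_left inner_add_right inner_commute power2_eq_square distrib_left)
    finally show "(norm (matrix_sqrt A *v y))\<^sup>2 \<le> (norm (?C *v y))\<^sup>2" by simp
  qed simp
  ultimately have "x \<bullet> (matrix_sqrt A *v x) \<le> x \<bullet> (?C *v x)"
    using psd(1) by (intro sqrt_operator_monotone)
  then show ?thesis
    by (simp add: C inner_add_right dot_square_norm)
qed

lemma continuous_on_inner_matrix_sqrt:
  fixes x :: "real ^ 'n"
  shows "continuous_on psd_matrices (\<lambda>A. x \<bullet> (matrix_sqrt A *v x))"
  unfolding continuous_on_iff
proof (intro ballI allI impI)
  fix A :: "real ^ 'n ^ 'n" and \<epsilon> :: real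
  assume A: "A \<in> psd_matrices" and \<epsilon>: "0 < \<epsilon>"
  define e where "e = \<epsilon> / ((norm x)\<^sup>2 + 1)"
  have n1: "(norm x)\<^sup>2 + 1 > 0"
    by (simp add: add_nonneg_pos)
  then have e: "e > 0"
    using \<epsilon> by (simp add: e_def)
  have "e * (norm x)\<^sup>2 < e * ((norm x)\<^sup>2 + 1)"
    using e by simp
  also have "\<dots> = \<epsilon>"
    using n1 by (simp add: e_def)
  finally have small: "e * (norm x)\<^sup>2 < \<epsilon>" .
  show "\<exists>d>0. \<forall>B\<in>psd_matrices. dist B A < d \<longrightarrow>
      dist (x \<bullet> (matrix_sqrt B *v x)) (x \<bullet> (matrix_sqrt A *v x)) < \<epsilon>"
  proof (intro exI[of _ "e\<^sup>2"] conjI ballI impI)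
    fix B :: "real ^ 'n ^ 'n"
    assume B: "B \<in> psd_matrices" and d: "dist B A < e\<^sup>2"
    have "norm (A - B) \<le> e\<^sup>2" "norm (B - A) \<le> e\<^sup>2"
      using d by (simp_all add: dist_norm norm_minus_commute)
    then show "dist (x \<bullet> (matrix_sqrt B *v x)) (x \<bullet> (matrix_sqrt A *v x)) < \<epsilon>"
      using matrix_sqrt_perturbation[OF A B, of e x] matrix_sqrt_perturbation[OF B A, of e x] e small
      by (simp add: dist_real_def)
  qed (use e in simp)
qed

lemma continuous_on_matrix_sqrt:
  "continuous_on psd_matrices (matrix_sqrt :: real ^ 'n ^ 'n \<Rightarrow> real ^ 'n ^ 'n)"
proof -
  let ?q = "\<lambda>x A. x \<bullet> (matrix_sqrt A *v x)"
  let ?f = "\<lambda>A::real^'n^'n. \<chi> i j. (?q (axis i 1 + axis j 1) A - ?q (axis i 1 - axis j 1) A) / 4"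
  have "matrix_sqrt A = ?f A" if "A \<in> psd_matrices" for A :: "real ^ 'n ^ 'n"
    using matrix_entry_polarization[of "matrix_sqrt A"] matrix_sqrt_psd[OF that]
    by (simp add: vec_eq_iff psd_matrices_def)
  then have "continuous_on psd_matrices (matrix_sqrt :: real ^ 'n ^ 'n \<Rightarrow> _) \<longleftrightarrow> continuous_on psd_matrices ?f"
    by (rule continuous_on_cong[OF refl])
  moreover have "continuous_on psd_matrices ?f"
    by (intro continuous_on_vec_lambda continuous_on_divide continuous_on_diff
        continuous_on_inner_matrix_sqrt continuous_on_const) simp
  ultimately show ?thesis by simp
qed

lemma bounded_linear_inner_matrix: "bounded_linear (\<lambda>A :: real ^ 'n ^ 'n. x \<bullet> (A *v y))"
  by (subst linear_conv_bounded_linear[symmetric], rule linearI)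
    (simp_all add: matrix_vector_mult_add_rdistrib inner_add_right scaleR_matrix_vector_assoc[symmetric])

lemma linear_matrix_congruence: "linear (\<lambda>M :: real ^ 'n ^ 'n. A ** M ** B)"
  by (rule linearI)
    (simp_all add: matrix_eq matrix_vector_mul_assoc[symmetric] matrix_vector_mult_add_rdistrib
      matrix_vector_right_distrib scaleR_matrix_vector_assoc[symmetric] matrix_vector_mult_scaleR)

lemma psd_congruence:
  fixes A M :: "real ^ 'n ^ 'n"
  assumes A: "\<And>x y. (A *v x) \<bullet> y = x \<bullet> (A *v y)" and M: "M \<in> psd_matrices"
  shows "A ** M ** A \<in> psd_matrices"
    and "x \<bullet> ((A ** M ** A) *v x) = (A *v x) \<bullet> (M *v (A *v x))"
proof -
  show *: "x \<bullet> ((A ** M ** A) *v x) = (A *v x) \<bullet> (M *v (A *v x))" for x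
    by (simp add: matrix_vector_mul_assoc[symmetric] A)
  show "A ** M ** A \<in> psd_matrices"
  proof (rule psdI)
    show "((A ** M ** A) *v x) \<bullet> y = x \<bullet> ((A ** M ** A) *v y)" for x y
      by (simp add: matrix_vector_mul_assoc[symmetric] A psd_symmetric[OF M])
    show "0 \<le> x \<bullet> ((A ** M ** A) *v x)" for x
      unfolding * by (rule psd_nonneg[OF M])
  qed
qed

section \<open>Optimal transport maps\<close>

lemma
  assumes A: "A \<in> spd_matrices"
  shows matrix_inv_sqrt_left: "matrix_inv (matrix_sqrt A) *v (matrix_sqrt A *v x) = x"
    and matrix_inv_sqrt_right: "matrix_sqrt A *v (matrix_inv (matrix_sqrt A) *v x) = x"
    and matrix_inv_sqrt_psd: "matrix_inv (matrix_sqrt A) \<in> psd_matrices"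
proof -
  let ?S = "matrix_sqrt A" and ?R = "matrix_inv (matrix_sqrt A)"
  note psd = spd_imp_psd[OF A]
  have "y = 0" if "?S *v y = 0" for y
  proof (rule ccontr)
    assume "y \<noteq> 0"
    then have "0 < y \<bullet> (A *v y)"
      using A by (simp add: spd_matrices_def)
    with that norm_psd_square[OF matrix_sqrt_psd[OF psd] matrix_sqrt_square[OF psd], of y]
    show False by simp
  qed
  then have "invertible ?S"
    by (auto simp: invertible_left_inverse matrix_left_invertible_ker)
  then have "?S ** ?R = mat 1 \<and> ?R ** ?S = mat 1"
    unfolding invertible_def matrix_inv_def by (rule someI_ex)
  then show left: "?R *v (?S *v x) = x" and right: "?S *v (?R *v x) = x" for x
    by (simp_all add: matrix_vector_mul_assoc)
  note S = matrix_sqrt_psd[OF psd]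
  show "?R \<in> psd_matrices"
  proof (rule psdI)
    show "(?R *v x) \<bullet> y = x \<bullet> (?R *v y)" for x y
      using psd_symmetric[OF S, of "?R *v x" "?R *v y"] by (simp add: right)
    show "0 \<le> x \<bullet> (?R *v x)" for x
      using psd_nonneg[OF S, of "?R *v x"] by (simp add: right inner_commute)
  qed
qed

lemma ot_map_psd:
  assumes A: "A \<in> spd_matrices" and B: "B \<in> spd_matrices"
  shows "ot_map A B \<in> psd_matrices"
proof -
  have "matrix_sqrt A ** B ** matrix_sqrt A \<in> psd_matrices"
    by (rule psd_congruence(1)[OF psd_symmetric[OF matrix_sqrt_psd[OF spd_imp_psd[OF A]]] spd_imp_psd[OF B]])
  from psd_congruence(1)[OF psd_symmetric[OF matrix_inv_sqrt_psd[OF A]] matrix_sqrt_psd[OF this]]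
  show ?thesis
    by (simp add: ot_map_def)
qed

lemma ot_map_self:
  assumes A: "A \<in> spd_matrices"
  shows "ot_map A A = mat 1"
proof -
  note S = matrix_sqrt_square[OF spd_imp_psd[OF A]]
  have "matrix_sqrt (matrix_sqrt A ** A ** matrix_sqrt A) = A"
  proof (rule matrix_sqrt_unique)
    show "A ** A = matrix_sqrt A ** A ** matrix_sqrt A"
      using S by (metis matrix_mul_assoc)
  qed (rule spd_imp_psd[OF A])
  moreover have "(matrix_inv (matrix_sqrt A) ** A ** matrix_inv (matrix_sqrt A)) *v x = x" for x
  proof -
    have "A *v y = matrix_sqrt A *v (matrix_sqrt A *v y)" for y
      by (simp add: matrix_vector_mul_assoc S)
    then show ?thesis
      by (simp add: matrix_vector_mul_assoc[symmetric] matrix_inv_sqrt_left[OF A] matrix_inv_sqrt_right[OF A])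
  qed
  ultimately show ?thesis
    unfolding ot_map_def by (simp add: matrix_eq[of _ "mat 1"])
qed

text \<open>The two-sided bound \<open>sqrt (lambda_min B) S\<^sup>-\<^sup>1 \<le> T \<le> sqrt (lambda_max B) S\<^sup>-\<^sup>1\<close> for the
  transport map \<open>T\<close> from \<open>A\<close> to \<open>B\<close>, where \<open>S\<close> is the square root of \<open>A\<close>.  Since
  \<open>lambda_min B S\<^sup>2 \<le> S B S \<le> lambda_max B S\<^sup>2\<close>, operator monotonicity bounds the root of
  \<open>S B S\<close> by multiples of \<open>S\<close>; conjugating with \<open>S\<^sup>-\<^sup>1\<close> gives the claim.  The lower bound feeds
  the eigenvalue estimate, the upper one integrability.\<close>
lemma
  fixes A :: "real ^ 'n ^ 'n"
  assumes A: "A \<in> spd_matrices" and B: "B \<in> spd_matrices"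
  shows ot_map_ge: "sqrt (lambda_min B) * (x \<bullet> (matrix_inv (matrix_sqrt A) *v x)) \<le> x \<bullet> (ot_map A B *v x)"
    and ot_map_le: "x \<bullet> (ot_map A B *v x) \<le> sqrt (lambda_max B) * (x \<bullet> (matrix_inv (matrix_sqrt A) *v x))"
proof -
  define S where "S = matrix_sqrt A"
  define N where "N = matrix_sqrt (S ** B ** S)"
  define w where "w = matrix_inv S *v x"
  have S: "S \<in> psd_matrices"
    unfolding S_def by (rule matrix_sqrt_psd[OF spd_imp_psd[OF A]])
  note cong = psd_congruence[OF psd_symmetric[OF S] spd_imp_psd[OF B]]
  have N: "N \<in> psd_matrices"
    unfolding N_def by (rule matrix_sqrt_psd[OF cong(1)])
  have N_norm: "(norm (N *v y))\<^sup>2 = (S *v y) \<bullet> (B *v (S *v y))" for y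
    using norm_psd_square[OF N matrix_sqrt_square[OF cong(1), folded N_def]] cong(2) by metis
  have B_sym: "transpose B = B"
    using B by (simp add: spd_matrices_def)
  have min_max: "0 \<le> lambda_min B" "0 \<le> lambda_max B"
  proof -
    let ?e = "axis undefined 1 :: real ^ 'n"
    show "0 \<le> lambda_min B"
      using lambda_min_pos[OF B] by simp
    then show "0 \<le> lambda_max B"
      using lambda_min_le_inner[OF B_sym, of ?e] inner_le_lambda_max[OF B_sym, of ?e] by simp
  qed
  have scaled: "c *\<^sub>R S \<in> psd_matrices" if "0 \<le> c" for c
    using that psd_nonneg[OF S]
    by (intro psdI) (auto simp: scaleR_matrix_vector_assoc[symmetric] psd_symmetric[OF S])
  have "w \<bullet> ((sqrt (lambda_min B) *\<^sub>R S) *v w) \<le> w \<bullet> (N *v w)"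
  proof (rule sqrt_operator_monotone[OF N scaled])
    show "norm ((sqrt (lambda_min B) *\<^sub>R S) *v y) \<le> norm (N *v y)" for y
      by (rule power2_le_imp_le)
        (use lambda_min_le_inner[OF B_sym, of "S *v y"] min_max in
          \<open>simp_all add: N_norm scaleR_matrix_vector_assoc[symmetric] power_mult_distrib\<close>)
  qed (use min_max in simp)
  moreover have "w \<bullet> (N *v w) \<le> w \<bullet> ((sqrt (lambda_max B) *\<^sub>R S) *v w)"
  proof (rule sqrt_operator_monotone[OF scaled N])
    show "norm (N *v y) \<le> norm ((sqrt (lambda_max B) *\<^sub>R S) *v y)" for y
      by (rule power2_le_imp_le)
        (use inner_le_lambda_max[OF B_sym, of "S *v y"] min_max in
          \<open>simp_all add: N_norm scaleR_matrix_vector_assoc[symmetric] power_mult_distrib\<close>)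
  qed (use min_max in simp)
  moreover have "w \<bullet> (N *v w) = x \<bullet> (ot_map A B *v x)"
    using psd_congruence(2)[OF psd_symmetric[OF matrix_inv_sqrt_psd[OF A]] N, of x]
    by (simp add: ot_map_def N_def S_def w_def)
  moreover have "w \<bullet> ((c *\<^sub>R S) *v w) = c * (x \<bullet> (matrix_inv S *v x))" for c
    by (simp add: w_def S_def scaleR_matrix_vector_assoc[symmetric] matrix_inv_sqrt_right[OF A] inner_commute)
  ultimately show "sqrt (lambda_min B) * (x \<bullet> (matrix_inv (matrix_sqrt A) *v x)) \<le> x \<bullet> (ot_map A B *v x)"
    "x \<bullet> (ot_map A B *v x) \<le> sqrt (lambda_max B) * (x \<bullet> (matrix_inv (matrix_sqrt A) *v x))"
    by (simp_all add: S_def)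
qed

text \<open>The growth in \<open>B\<close> is really of order \<open>sqrt (lambda_max B)\<close>; the linear bound is enough for
  integrability.\<close>
lemma norm_ot_map_le:
  fixes A :: "real ^ 'n ^ 'n"
  assumes A: "A \<in> spd_matrices"
  obtains C where "0 \<le> C" "\<And>B. B \<in> spd_matrices \<Longrightarrow> norm (ot_map A B) \<le> C * (1 + lambda_max B)"
proof -
  let ?R = "matrix_inv (matrix_sqrt A)"
  define C where "C = real CARD('n) * (real CARD('n) * norm ?R)"
  have C0: "0 \<le> C"
    by (simp add: C_def)
  have "norm (ot_map A B) \<le> C * (1 + lambda_max B)" if B: "B \<in> spd_matrices" for B
  proof -
    have B_sym: "transpose B = B"
      using B by (simp add: spd_matrices_def)
    have max0: "0 \<le> lambda_max B"
      using inner_le_lambda_max[OF B_sym, of "axis undefined 1"]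
        psd_nonneg[OF spd_imp_psd[OF B], of "axis undefined 1"] by simp
    have "norm (ot_map A B) \<le> real CARD('n) * (real CARD('n) * (sqrt (lambda_max B) * norm ?R))"
    proof (rule norm_psd_le[OF ot_map_psd[OF A B]])
      fix x :: "real ^ 'n"
      have "x \<bullet> (ot_map A B *v x) \<le> sqrt (lambda_max B) * (x \<bullet> (?R *v x))"
        by (rule ot_map_le[OF A B])
      also have "\<dots> \<le> sqrt (lambda_max B) * (norm ?R * (norm x)\<^sup>2)"
        using max0 inner_matrix_le_norm[of x ?R] by (intro mult_left_mono) auto
      finally show "x \<bullet> (ot_map A B *v x) \<le> sqrt (lambda_max B) * norm ?R * (norm x)\<^sup>2"
        by (simp add: mult.assoc)
    qed
    also have "\<dots> = C * sqrt (lambda_max B)"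
      by (simp add: C_def)
    also have "sqrt (lambda_max B) \<le> 1 + lambda_max B"
    proof (rule real_le_lsqrt)
      have "1 + lambda_max B \<le> (1 + lambda_max B) * (1 + lambda_max B)"
        using max0 by (intro mult_le_cancel_left1[THEN iffD2]) auto
      then show "lambda_max B \<le> (1 + lambda_max B)\<^sup>2"
        by (simp add: power2_eq_square)
    qed (use max0 in auto)
    finally show ?thesis
      using C0 by (simp add: mult_left_mono)
  qed
  with C0 that show thesis by blast
qed

lemma space_spd_borel [simp]: "space spd_borel = spd_matrices"
  by (simp add: spd_borel_def space_restrict_space)

lemma ot_map_measurable:
  fixes A :: "real ^ 'n ^ 'n"
  assumes A: "A \<in> spd_matrices"
  shows "ot_map A \<in> borel_measurable spd_borel"
  unfolding spd_borel_def
proof (rule borel_measurable_continuous_on_restrict)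
  let ?S = "matrix_sqrt A" and ?R = "matrix_inv (matrix_sqrt A)"
  have lin: "continuous_on X (\<lambda>M. P ** M ** P)" for X and P :: "real ^ 'n ^ 'n"
    using linear_continuous_on linear_matrix_congruence linear_conv_bounded_linear by blast
  have "(\<lambda>B. ?S ** B ** ?S) ` spd_matrices \<subseteq> psd_matrices"
    using psd_congruence(1)[OF psd_symmetric[OF matrix_sqrt_psd[OF spd_imp_psd[OF A]]] spd_imp_psd]
    by blast
  then have "continuous_on spd_matrices (\<lambda>B. matrix_sqrt (?S ** B ** ?S))"
    by (rule continuous_on_compose2[OF continuous_on_matrix_sqrt lin])
  then show "continuous_on spd_matrices (ot_map A)"
    unfolding ot_map_def by (rule continuous_on_compose2[OF lin[of UNIV]]) auto
qed

section \<open>The mean transport map of a mixture\<close>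

lemma nn_integral_mixture:
  assumes sets: "sets N = sets M" and f: "f \<in> borel_measurable M"
  shows "(\<integral>\<^sup>+x. f x \<partial>mixture t M N) = ennreal (1 - t) * (\<integral>\<^sup>+x. f x \<partial>M) + ennreal t * (\<integral>\<^sup>+x. f x \<partial>N)"
  using f
proof (induction rule: borel_measurable_induct)
  have meas: "g \<in> borel_measurable (mixture t M N)" "g \<in> borel_measurable N"
    if "g \<in> borel_measurable M" for g :: "'a \<Rightarrow> ennreal"
    using that measurable_cong_sets[OF sets_mixture[of t M N] refl, of borel] measurable_cong_sets[OF sets refl, of borel]
    by auto
  have space: "space N = space M"
    using sets by (rule sets_eq_imp_space_eq)
  {
    case (cong f g)
    then have "integral\<^sup>N L f = integral\<^sup>N L g" if "space L = space M" for L
      using that by (intro nn_integral_cong) simp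
    with cong.IH space show ?case by simp
  next
    case (set A)
    then show ?case
      using sets by (simp add: emeasure_mixture)
  next
    case (mult u c)
    then show ?case
      by (simp add: nn_integral_cmult meas distrib_left mult_ac)
  next
    case (add u v)
    then show ?case
      by (simp add: nn_integral_add meas distrib_left add_ac)
  next
    case (seq U)
    have SUP: "integral\<^sup>N L (SUP i. U i) = (SUP i. integral\<^sup>N L (U i))"
      if "\<And>i. U i \<in> borel_measurable L" for L
    proof -
      have "(SUP i. U i) = (\<lambda>x. SUP i. U i x)"
        by (simp add: fun_eq_iff image_comp)
      then show ?thesis
        using nn_integral_monotone_convergence_SUP[OF seq.hyps(3) that] by simp
    qed
    have mono: "mono (\<lambda>i. c * integral\<^sup>N L (U i))" for c L
      using seq.hyps(3) by (auto simp: mono_def le_fun_def intro!: mult_left_mono nn_integral_mono)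
    show ?case
      using seq.hyps(1) by (simp only: SUP meas seq.IH SUP_mult_left_ennreal ennreal_SUP_add[OF mono mono])
  }
qed

lemma ennreal_le_if_square_le:
  assumes "0 \<le> a" "ennreal a \<le> J\<^sup>2"
  shows "ennreal (sqrt a) \<le> J"
proof (cases J)
  case (real j)
  then have "a \<le> j\<^sup>2"
    using assms by (simp add: ennreal_power)
  then have "sqrt a \<le> j"
    using real(1) by (rule real_le_lsqrt[rotated]) 
  then show ?thesis
    using real by (simp add: ennreal_leI)
qed simp

text \<open>The Bochner integral behind the mean transport map is zero unless it converges, so the first
  thing to establish is integrability, which follows from the bound on \<open>lambda_max\<close>.  The integral then
  commutes with the linear functionals \<open>M \<mapsto> x \<bullet> M y\<close>.  The quadratic form is stated with a
  nonnegative integral because that is how the lower bound on \<open>lambda_min\<close> is given.\<close>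
lemma mean_ot_map_mixture:
  fixes A :: "real ^ 'n ^ 'n" and Q :: "(real ^ 'n ^ 'n) measure" and t :: real
  assumes A: "A \<in> spd_matrices" and Q: "prob_space Q" and sets_Q: "sets Q = sets spd_borel"
    and fin: "(\<integral>\<^sup>+S. ennreal (lambda_max S) \<partial>Q) < \<infinity>"
  defines "T \<equiv> mean_ot_map A (mixture t (return spd_borel A) Q)"
  shows mean_ot_map_psd: "T \<in> psd_matrices"
    and mean_ot_map_inner: "ennreal (x \<bullet> (T *v x)) =
      ennreal (1 - t) * ennreal ((norm x)\<^sup>2) + ennreal t * (\<integral>\<^sup>+S. ennreal (x \<bullet> (ot_map A S *v x)) \<partial>Q)"
proof -
  interpret Q: prob_space Q by (rule Q)
  let ?M = "mixture t (return spd_borel A) Q"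
  have sets_M: "sets ?M = sets spd_borel"
    by simp
  have space_Q: "space Q = spd_matrices" and space_M: "space ?M = spd_matrices"
    using sets_eq_imp_space_eq[OF sets_Q] by simp_all
  note ot = ot_map_measurable[OF A]
  have ot_M: "ot_map A \<in> borel_measurable ?M" and ot_Q: "ot_map A \<in> borel_measurable Q"
    using ot measurable_cong_sets[OF sets_M refl] measurable_cong_sets[OF sets_Q refl] by blast+
  have mix: "(\<integral>\<^sup>+S. f S \<partial>?M) = ennreal (1 - t) * f A + ennreal t * (\<integral>\<^sup>+S. f S \<partial>Q)"
    if f: "f \<in> borel_measurable spd_borel" for f
  proof -
    have "f \<in> borel_measurable (return spd_borel A)"
      using f by simp
    then show ?thesis
      using nn_integral_mixture[of Q "return spd_borel A" f t] sets_Q nn_integral_return[OF _ f] A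
      by simp
  qed
  obtain C where C: "0 \<le> C" "\<And>B. B \<in> spd_matrices \<Longrightarrow> norm (ot_map A B) \<le> C * (1 + lambda_max B)"
    using norm_ot_map_le[OF A] by blast
  have "(\<integral>\<^sup>+S. ennreal (norm (ot_map A S)) \<partial>Q) < \<infinity>"
  proof (cases "C = 0")
    case True
    then have "(\<integral>\<^sup>+S. ennreal (norm (ot_map A S)) \<partial>Q) = (\<integral>\<^sup>+S. 0 \<partial>Q)"
      using C(2) by (intro nn_integral_cong) (simp add: space_Q)
    then show ?thesis by simp
  next
    case False
    \<comment> \<open>The additivity of the integral needs measurability, which the minorant \<open>?h\<close> of
      \<open>lambda_max\<close> inherits from \<open>ot_map A\<close>.\<close>
    let ?h = "\<lambda>S. norm (ot_map A S) / C - 1"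
    have h: "?h \<in> borel_measurable Q"
      using ot_Q by measurable
    have "(\<integral>\<^sup>+S. ennreal (norm (ot_map A S)) \<partial>Q) \<le> (\<integral>\<^sup>+S. ennreal C * (1 + ennreal (?h S)) \<partial>Q)"
    proof (intro nn_integral_mono)
      fix S
      have "norm (ot_map A S) = C * (1 + ?h S)"
        using False by (simp add: field_simps)
      also have "\<dots> \<le> C * (1 + max 0 (?h S))"
        using C(1) by (intro mult_left_mono) auto
      finally have "ennreal (norm (ot_map A S)) \<le> ennreal (C * (1 + max 0 (?h S)))"
        by (rule ennreal_leI)
      also have "\<dots> = ennreal C * (1 + ennreal (?h S))"
        using C(1) ennreal_max_0[of "?h S"] by (simp add: ennreal_mult ennreal_max_0 ennreal_plus)
      finally show "ennreal (norm (ot_map A S)) \<le> ennreal C * (1 + ennreal (?h S))" .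
    qed
    also have "\<dots> = ennreal C * (1 + (\<integral>\<^sup>+S. ennreal (?h S) \<partial>Q))"
      using h by (simp add: nn_integral_cmult nn_integral_add Q.emeasure_space_1)
    also have "(\<integral>\<^sup>+S. ennreal (?h S) \<partial>Q) \<le> (\<integral>\<^sup>+S. ennreal (lambda_max S) \<partial>Q)"
      using C False by (intro nn_integral_mono ennreal_leI) (simp add: space_Q field_simps)
    also have "ennreal C * (1 + (\<integral>\<^sup>+S. ennreal (lambda_max S) \<partial>Q)) < \<infinity>"
      using fin by (simp add: ennreal_mult_less_top)
    finally show ?thesis
      by (simp add: mult_left_mono add_left_mono)
  qed
  then have int: "integrable ?M (ot_map A)"
    using ot ot_M by (intro integrableI_bounded) (simp_all add: mix ennreal_mult_less_top)
  have T: "T = (\<integral>S. ot_map A S \<partial>?M)"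
    by (simp add: T_def mean_ot_map_def)
  have inner_T: "x \<bullet> (T *v y) = (\<integral>S. x \<bullet> (ot_map A S *v y) \<partial>?M)" for x y
    unfolding T by (rule integral_bounded_linear[OF bounded_linear_inner_matrix int, symmetric])
  show "T \<in> psd_matrices"
  proof (rule psdI)
    fix x y
    have "y \<bullet> (T *v x) = x \<bullet> (T *v y)"
      unfolding inner_T
    proof (intro Bochner_Integration.integral_cong refl)
      fix S assume "S \<in> space ?M"
      then show "y \<bullet> (ot_map A S *v x) = x \<bullet> (ot_map A S *v y)"
        using psd_symmetric[OF ot_map_psd[OF A], of S x y] space_M by (simp add: inner_commute)
    qed
    then show "(T *v x) \<bullet> y = x \<bullet> (T *v y)"
      by (simp add: inner_commute)
    show "0 \<le> x \<bullet> (T *v x)"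
      unfolding inner_T
      by (intro Bochner_Integration.integral_nonneg_AE AE_I2) (simp add: space_M psd_nonneg ot_map_psd[OF A])
  qed
  have q: "(\<lambda>S. ennreal (x \<bullet> (ot_map A S *v x))) \<in> borel_measurable spd_borel"
    using measurable_compose[OF ot borel_measurable_continuous_onI[OF linear_continuous_on[OF bounded_linear_inner_matrix]]]
    by simp
  have "ennreal (x \<bullet> (T *v x)) = (\<integral>\<^sup>+S. ennreal (x \<bullet> (ot_map A S *v x)) \<partial>?M)"
    unfolding inner_T
    by (intro nn_integral_eq_integral[symmetric] integrable_bounded_linear[OF bounded_linear_inner_matrix int] AE_I2)
      (simp add: space_M psd_nonneg ot_map_psd[OF A])
  also have "\<dots> = ennreal (1 - t) * ennreal ((norm x)\<^sup>2) +
      ennreal t * (\<integral>\<^sup>+S. ennreal (x \<bullet> (ot_map A S *v x)) \<partial>Q)"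
    by (simp add: mix[OF q] ot_map_self[OF A] dot_square_norm)
  finally show "ennreal (x \<bullet> (T *v x)) =
      ennreal (1 - t) * ennreal ((norm x)\<^sup>2) + ennreal t * (\<integral>\<^sup>+S. ennreal (x \<bullet> (ot_map A S *v x)) \<partial>Q)" .
qed

text \<open>The integrated form of the lower bound \<open>sqrt (lambda_min B) S\<^sup>-\<^sup>1 \<le> T\<close>.  Dividing by the
  number \<open>p = x \<bullet> S\<^sup>-\<^sup>1 x\<close> first leaves only the measurable function \<open>x \<bullet> T x\<close> to be scaled
  under the integral.\<close>
lemma ot_map_nn_integral_ge:
  fixes A :: "real ^ 'n ^ 'n" and Q :: "(real ^ 'n ^ 'n) measure"
  assumes A: "A \<in> spd_matrices" and sets_Q: "sets Q = sets spd_borel" and "0 \<le> a"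
    and ge: "ennreal a \<le> (\<integral>\<^sup>+S. ennreal (sqrt (lambda_min S)) \<partial>Q)\<^sup>2"
  shows "ennreal (sqrt a * (x \<bullet> (matrix_inv (matrix_sqrt A) *v x)))
    \<le> (\<integral>\<^sup>+S. ennreal (x \<bullet> (ot_map A S *v x)) \<partial>Q)"
proof (cases "x \<bullet> (matrix_inv (matrix_sqrt A) *v x) = 0")
  case False
  define p where "p = x \<bullet> (matrix_inv (matrix_sqrt A) *v x)"
  have p: "p > 0"
    using False psd_nonneg[OF matrix_inv_sqrt_psd[OF A], of x] by (simp add: p_def)
  have "ot_map A \<in> borel_measurable Q"
    using ot_map_measurable[OF A] measurable_cong_sets[OF sets_Q refl] by blast
  then have q: "(\<lambda>S. x \<bullet> (ot_map A S *v x)) \<in> borel_measurable Q"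
    by (rule measurable_compose)
      (intro borel_measurable_continuous_onI linear_continuous_on bounded_linear_inner_matrix)
  have "ennreal (sqrt a) \<le> (\<integral>\<^sup>+S. ennreal (sqrt (lambda_min S)) \<partial>Q)"
    using \<open>0 \<le> a\<close> ge by (rule ennreal_le_if_square_le)
  also have "\<dots> \<le> (\<integral>\<^sup>+S. ennreal (1 / p) * ennreal (x \<bullet> (ot_map A S *v x)) \<partial>Q)"
  proof (rule nn_integral_mono)
    fix S assume "S \<in> space Q"
    then have S: "S \<in> spd_matrices"
      using sets_eq_imp_space_eq[OF sets_Q] by simp
    have "sqrt (lambda_min S) \<le> 1 / p * (x \<bullet> (ot_map A S *v x))"
      using ot_map_ge[OF A S, of x] p by (simp add: p_def[symmetric] field_simps)
    then show "ennreal (sqrt (lambda_min S)) \<le> ennreal (1 / p) * ennreal (x \<bullet> (ot_map A S *v x))"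
      using p psd_nonneg[OF ot_map_psd[OF A S], of x] by (simp add: ennreal_mult[symmetric] ennreal_leI)
  qed
  also have "\<dots> = ennreal (1 / p) * (\<integral>\<^sup>+S. ennreal (x \<bullet> (ot_map A S *v x)) \<partial>Q)"
    by (intro nn_integral_cmult measurable_compose[OF q measurable_ennreal])
  finally have "ennreal p * ennreal (sqrt a) \<le>
      ennreal p * (ennreal (1 / p) * (\<integral>\<^sup>+S. ennreal (x \<bullet> (ot_map A S *v x)) \<partial>Q))"
    by (rule mult_left_mono) simp
  moreover have "ennreal p * ennreal (1 / p) = 1"
    using p by (simp add: ennreal_mult[symmetric])
  moreover have "ennreal (sqrt a * p) = ennreal p * ennreal (sqrt a)"
    using p \<open>0 \<le> a\<close> by (simp add: ennreal_mult mult.commute)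
  ultimately show ?thesis
    by (simp add: p_def mult.assoc[symmetric])
qed simp

lemma inner_mean_ot_map_ge:
  fixes A :: "real ^ 'n ^ 'n" and Q :: "(real ^ 'n ^ 'n) measure"
  assumes A: "A \<in> spd_matrices" and Q: "prob_space Q" and sets_Q: "sets Q = sets spd_borel"
    and fin: "(\<integral>\<^sup>+S. ennreal (lambda_max S) \<partial>Q) < \<infinity>"
    and a: "0 \<le> a" and ge: "ennreal a \<le> (\<integral>\<^sup>+S. ennreal (sqrt (lambda_min S)) \<partial>Q)\<^sup>2"
    and t: "0 \<le> t" "t \<le> 1"
  shows "(1 - t) * (norm x)\<^sup>2 + t * (sqrt a * (x \<bullet> (matrix_inv (matrix_sqrt A) *v x)))
    \<le> x \<bullet> (mean_ot_map A (mixture t (return spd_borel A) Q) *v x)"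
proof -
  let ?T = "mean_ot_map A (mixture t (return spd_borel A) Q)"
  let ?p = "sqrt a * (x \<bullet> (matrix_inv (matrix_sqrt A) *v x))"
  have p0: "0 \<le> ?p"
    using a psd_nonneg[OF matrix_inv_sqrt_psd[OF A], of x] by simp
  have "ennreal ((1 - t) * (norm x)\<^sup>2 + t * ?p) = ennreal (1 - t) * ennreal ((norm x)\<^sup>2) + ennreal t * ennreal ?p"
    using t p0 by (simp add: ennreal_mult[symmetric] ennreal_plus[symmetric] del: ennreal_plus)
  also have "\<dots> \<le> ennreal (x \<bullet> (?T *v x))"
    unfolding mean_ot_map_inner[OF A Q sets_Q fin]
    by (intro add_left_mono mult_left_mono ot_map_nn_integral_ge[OF A sets_Q a ge]) simp
  finally have *: "ennreal ((1 - t) * (norm x)\<^sup>2 + t * ?p) \<le> ennreal (x \<bullet> (?T *v x))" .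
  have "0 \<le> x \<bullet> (?T *v x)"
    by (rule psd_nonneg[OF mean_ot_map_psd[OF A Q sets_Q fin]])
  with * show ?thesis
    by (simp only: ennreal_le_iff)
qed

section \<open>The eigenvalue estimate\<close>

text \<open>If the eigenvalues of \<open>A\<close> are at least \<open>a\<^sup>2\<close>, then its root \<open>S\<close> satisfies \<open>a I \<le> S\<close>.
  Evaluated at \<open>S\<^sup>-\<^sup>1 x\<close> this reads \<open>a S\<^sup>-\<^sup>2 \<le> S\<^sup>-\<^sup>1\<close>.\<close>
lemma sqrt_inverse_bound:
  fixes A :: "real ^ 'n ^ 'n"
  assumes A: "A \<in> spd_matrices" and "0 < a" and eig: "\<forall>c \<in> eigenvalues A. a\<^sup>2 \<le> c"
  shows "a * (norm (matrix_inv (matrix_sqrt A) *v x))\<^sup>2 \<le> x \<bullet> (matrix_inv (matrix_sqrt A) *v x)"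
proof -
  let ?S = "matrix_sqrt A" and ?w = "matrix_inv (matrix_sqrt A) *v x"
  have sym: "transpose A = A"
    using A by (simp add: spd_matrices_def)
  note psd = spd_imp_psd[OF A]
  have aI: "(a *\<^sub>R mat 1) *v y = a *\<^sub>R y" for y :: "real ^ 'n"
    by (rule scaleR_mat_one_vector)
  have "?w \<bullet> ((a *\<^sub>R mat 1) *v ?w) \<le> ?w \<bullet> (?S *v ?w)"
  proof (rule sqrt_operator_monotone[OF matrix_sqrt_psd[OF psd]])
    show "a *\<^sub>R (mat 1 :: real ^ 'n ^ 'n) \<in> psd_matrices"
      using \<open>0 < a\<close> by (intro psdI) (simp_all add: aI)
    fix y :: "real ^ 'n"
    have "a\<^sup>2 * (norm y)\<^sup>2 \<le> lambda_min A * (norm y)\<^sup>2"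
      using eig lambda_min_in_eigenvalues[OF sym] by (intro mult_right_mono) auto
    also have "\<dots> \<le> y \<bullet> (A *v y)"
      by (rule lambda_min_le_inner[OF sym])
    also have "\<dots> = (norm (?S *v y))\<^sup>2"
      by (rule norm_psd_square[OF matrix_sqrt_psd[OF psd] matrix_sqrt_square[OF psd], symmetric])
    finally have "(norm (a *\<^sub>R y))\<^sup>2 \<le> (norm (?S *v y))\<^sup>2"
      using \<open>0 < a\<close> by (simp add: power_mult_distrib)
    then show "norm ((a *\<^sub>R mat 1) *v y) \<le> norm (?S *v y)"
      unfolding aI by (rule power2_le_imp_le) simp
  qed
  then show ?thesis
    by (simp add: aI matrix_inv_sqrt_right[OF A] inner_commute dot_square_norm)
qed

text \<open>The matrix \<open>T A T\<close> is not monotone in \<open>T\<close>, so the lower bound on \<open>T\<close> cannot simply be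
  substituted.  Instead, with \<open>S\<close> the root of \<open>A\<close>, the vector \<open>S T v\<close>, whose squared norm is
  \<open>v \<bullet> T A T v\<close>, is tested against \<open>w = S\<^sup>-\<^sup>1 v\<close>.  By Cauchy-Schwarz its norm is at least
  \<open>v \<bullet> T v / |w|\<close>, which is linear in \<open>T\<close>.
  What remains is an inequality between the numbers \<open>n = |v|\<close> and \<open>u = a |w|\<close> with \<open>u \<le> n\<close>:
  \<open>n u \<le> (1 - t) n\<^sup>2 + 2 t u\<^sup>2\<close>.  It is affine in \<open>t\<close>, trivial at \<open>t = 0\<close>, and at
  \<open>t = 1/2\<close> it says \<open>0 \<le> (n - u)\<^sup>2 + u\<^sup>2\<close>.\<close>
lemma congruence_eigenvalue_ge:
  assumes A: "A \<in> spd_matrices" and T: "T \<in> psd_matrices" and "0 < a"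
    and eig: "\<forall>c \<in> eigenvalues A. a\<^sup>2 \<le> c"
    and t: "0 \<le> t" "t \<le> 1 / 2"
    and ge: "\<And>x. (1 - t) * (norm x)\<^sup>2 + 2 * t * a * (x \<bullet> (matrix_inv (matrix_sqrt A) *v x)) \<le> x \<bullet> (T *v x)"
    and c: "c \<in> eigenvalues (T ** A ** T)"
  shows "a\<^sup>2 \<le> c"
proof -
  let ?S = "matrix_sqrt A" and ?R = "matrix_inv (matrix_sqrt A)"
  note psd = spd_imp_psd[OF A]
  obtain v where v: "v \<noteq> 0" "(T ** A ** T) *v v = c *s v"
    using c by (auto simp: eigenvalues_def)
  define n m k p where "n = norm v" and "m = norm (?R *v v)" and "k = norm (?S *v (T *v v))"
    and "p = v \<bullet> (?R *v v)"
  have pos: "0 < n" "0 \<le> m" "0 \<le> k"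
    using v(1) by (simp_all add: n_def m_def k_def)
  have k2: "k\<^sup>2 = c * n\<^sup>2"
    using norm_psd_square[OF matrix_sqrt_psd[OF psd] matrix_sqrt_square[OF psd], of "T *v v"]
      psd_congruence(2)[OF psd_symmetric[OF T] psd, of v] eigenvector_inner[OF v(2)]
    by (simp add: k_def n_def)
  have "v \<bullet> (T *v v) = (?R *v v) \<bullet> (?S *v (T *v v))"
    by (simp add: psd_symmetric[OF matrix_inv_sqrt_psd[OF A]] matrix_inv_sqrt_left[OF A])
  also have "\<dots> \<le> m * k"
    unfolding m_def k_def by (rule norm_cauchy_schwarz)
  finally have mk: "(1 - t) * n\<^sup>2 + 2 * t * a * p \<le> m * k"
    using ge[of v] by (simp add: n_def p_def)
  have amp: "a * m\<^sup>2 \<le> p"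
    using sqrt_inverse_bound[OF A \<open>0 < a\<close> eig] by (simp add: m_def p_def)
  define u where "u = a * m"
  have "a * p \<ge> u\<^sup>2"
    using mult_left_mono[OF amp, of a] \<open>0 < a\<close> by (simp add: u_def power2_eq_square mult_ac)
  then have "2 * t * (a * p) \<ge> 2 * t * u\<^sup>2"
    using t by (intro mult_left_mono) auto
  with mk have le: "(1 - t) * n\<^sup>2 + 2 * t * u\<^sup>2 \<le> m * k"
    by (simp add: mult.assoc)
  have un: "u \<le> n"
  proof -
    have "p \<le> n * m"
      unfolding p_def n_def m_def by (rule norm_cauchy_schwarz)
    with amp have "u * m \<le> n * m"
      by (simp add: u_def power2_eq_square mult_ac)
    then show ?thesis
      using pos by (cases "m = 0") (auto simp: u_def)
  qed
  \<comment> \<open>The convex combination of the cases \<open>t = 0\<close> and \<open>t = 1/2\<close>.\<close>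
  have "n * u \<le> (1 - t) * n\<^sup>2 + 2 * t * u\<^sup>2"
  proof -
    have "(1 - t) * n\<^sup>2 + 2 * t * u\<^sup>2 - n * u =
        (1 - 2 * t) * (n * (n - u)) + t * ((n - u)\<^sup>2 + u\<^sup>2)"
      by (simp add: power2_eq_square algebra_simps)
    moreover have "0 \<le> (1 - 2 * t) * (n * (n - u))" "0 \<le> t * ((n - u)\<^sup>2 + u\<^sup>2)"
      using t un pos by simp_all
    ultimately show ?thesis by linarith
  qed
  with le have "m * (a * n) \<le> m * k"
    by (simp add: u_def mult_ac)
  moreover have "0 < m"
  proof -
    have "?R *v v \<noteq> 0"
      using matrix_inv_sqrt_right[OF A, of v] v(1) by auto
    then show ?thesis by (simp add: m_def)
  qed
  ultimately have "a * n \<le> k"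
    by simp
  then have "(a * n)\<^sup>2 \<le> k\<^sup>2"
    using \<open>0 < a\<close> pos by (intro power_mono) auto
  then show ?thesis
    using pos by (simp add: k2 power_mult_distrib)
qed

theorem theorem1:
  fixes \<alpha> \<beta> \<eta> :: real
    and Q :: "(real ^ 'n ^ 'n) measure"
    and \<Sigma>\<^sub>0 :: "real ^ 'n ^ 'n"
  assumes "0 < \<alpha>" and "\<alpha> \<le> \<beta>"
    and "prob_space Q" and "sets Q = sets spd_borel"
    and "(\<integral>\<^sup>+S. ennreal (sqrt (lambda_min S)) \<partial>Q)\<^sup>2 \<ge> ennreal \<alpha>"
    and "(\<integral>\<^sup>+S. ennreal (lambda_max S) \<partial>Q) \<le> ennreal \<beta>"
    and "\<Sigma>\<^sub>0 \<in> spd_matrices"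
    and "\<forall>c \<in> eigenvalues \<Sigma>\<^sub>0. \<alpha> / 4 \<le> c"
    and "0 \<le> \<eta>" and "\<eta> \<le> \<alpha> / (2 * \<beta>)"
  shows "\<forall>c \<in> eigenvalues (generalized_barycenter \<Sigma>\<^sub>0
           (mixture \<eta> (return spd_borel \<Sigma>\<^sub>0) Q)). \<alpha> / 4 \<le> c"
proof
  fix c
  assume c: "c \<in> eigenvalues (generalized_barycenter \<Sigma>\<^sub>0 (mixture \<eta> (return spd_borel \<Sigma>\<^sub>0) Q))"
  let ?T = "mean_ot_map \<Sigma>\<^sub>0 (mixture \<eta> (return spd_borel \<Sigma>\<^sub>0) Q)"
  \<comment> \<open>Chosen so that the threshold \<open>\<alpha> / 4\<close> is \<open>a\<^sup>2\<close> and the lower bound \<open>sqrt \<alpha> S\<^sup>-\<^sup>1\<close> on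
    the mean of the transport maps over \<open>Q\<close> is \<open>2 a S\<^sup>-\<^sup>1\<close>.\<close>
  define a where "a = sqrt \<alpha> / 2"
  have a: "0 < a" "a\<^sup>2 = \<alpha> / 4" "sqrt \<alpha> = 2 * a"
    using assms(1) by (simp_all add: a_def power_divide)
  have "\<alpha> / (2 * \<beta>) \<le> 1 / 2"
    using assms(1,2) by (simp add: field_simps)
  then have t: "\<eta> \<le> 1 / 2"
    using assms(10) by linarith
  have fin: "(\<integral>\<^sup>+S. ennreal (lambda_max S) \<partial>Q) < \<infinity>"
    using assms(6) by (rule le_less_trans) simp
  have ge: "(1 - \<eta>) * (norm x)\<^sup>2 + 2 * \<eta> * a * (x \<bullet> (matrix_inv (matrix_sqrt \<Sigma>\<^sub>0) *v x)) \<le> x \<bullet> (?T *v x)" for x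
    using inner_mean_ot_map_ge[OF assms(7,3,4) fin _ assms(5,9), of x] assms(1) t a(3)
    by (simp add: mult_ac)
  have "a\<^sup>2 \<le> c"
  proof (rule congruence_eigenvalue_ge[OF assms(7) mean_ot_map_psd[OF assms(7,3,4) fin] a(1) _ assms(9) t ge])
    show "\<forall>c \<in> eigenvalues \<Sigma>\<^sub>0. a\<^sup>2 \<le> c"
      using assms(8) by (simp add: a(2))
    show "c \<in> eigenvalues (?T ** \<Sigma>\<^sub>0 ** ?T)"
      using c by (simp add: generalized_barycenter_def)
  qed
  then show "\<alpha> / 4 \<le> c"
    by (simp add: a(2))
qed

end
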